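(* For $(x,y)\in\mathbb{N}^2$, the following are equivalent: (1) $T(x,y)=1$; (2) $E(x,y)$ has non-empty interior; (3) $E(x,y)$ has positive Lebesgue measure; (4) $\dim_H E(x,y)=1$; (5) the semigroup generated by $\mathcal{F}_{x,y}$ is free, i.e. it is freely generated by the four listed maps $f_0,f_x,f_y,f_{x+y}$ (distinct finite words in the four indexed generators give distinct compositions; no exact overlaps); (6) $\mathcal{F}_{x,y}$ satisfies the open set condition.
   Context: $\mathbb{N}$ denotes the positive integers. For $(x,y)\in\mathbb{N}^2$, $$E(x,y)=\left\{\sum_{n=1}^{\infty}\frac{\varepsilon_n}{4^n}:(\varepsilon_n)\in\{0,x,y,x+y\}^{\mathbb{N}}\right\}\subset\mathbb{R},$$ which is the attractor of the iterated function system $\mathcal{F}_{x,y}=(f_0,f_x,f_y,f_{x+y})$, an indexed $4$-tuple of maps $f_d(z)=(z+d)/4$ on $\mathbb{R}$. When $x=y$ the second and third maps coincide as maps but are still counted as two members of the tuple (so there is an exact overlap at the first level). $\mathcal{F}_{x,y}$ satisfies the open set condition if there is a non-empty open set $O\subset\mathbb{R}$ with $f_0(O)\cup f_x(O)\cup f_y(O)\cup f_{x+y}(O)\subset O$ and the four sets in the union (indexed by the four members of the tuple) pairwise disjoint; in particular it fails when $x=y$. $\dim_H$ is Hausdorff dimension. $V$ is the set of positive integers whose last non-zero digit in base $4$ is $1$ or $3$, and $D=\mathbb{N}\setminus V$. The function $c:\mathbb{N}\to\{0,1\}$ is $c(n)=1$ if $n\in V$, $c(n)=0$ if $n\in D$,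 and $T(x,y)=1$ if $c(x)\neq c(y)$, $T(x,y)=0$ if $c(x)=c(y)$. *)

theory Defs
  imports "HOL-Analysis.Analysis"
begin

text \<open>The case distinction implements the conventions that the empty set contributes
  0 and that every non-empty set contributes 1 when the exponent is 0; note that
  \<open>0 powr 0 = 0\<close> in HOL.\<close>

definition diam_power :: "real \<Rightarrow> 'a::metric_space set \<Rightarrow> ennreal" where
  "diam_power s U =
     (if U = {} then 0 else if s = 0 then 1 else ennreal (diameter U powr s))"

text \<open>Covering sets are required to be bounded because \<^const>\<open>diameter\<close> is meaningless
  on unbounded sets. Finite covers are included, padded with empty sets.\<close>

definition hausdorff_premeasure :: "real \<Rightarrow> real \<Rightarrow> 'a::metric_space set \<Rightarrow> ennreal" where
  "hausdorff_premeasure s \<delta> A =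
     Inf {(\<Sum>i. diam_power s (U i)) | U :: nat \<Rightarrow> 'a set.
            A \<subseteq> (\<Union>i. U i) \<and> (\<forall>i. bounded (U i) \<and> diameter (U i) \<le> \<delta>)}"

definition hausdorff_measure :: "real \<Rightarrow> 'a::metric_space set \<Rightarrow> ennreal" where
  "hausdorff_measure s A = (SUP \<delta>\<in>{0<..}. hausdorff_premeasure s \<delta> A)"

definition hausdorff_dim :: "'a::metric_space set \<Rightarrow> ennreal" where
  "hausdorff_dim A = Inf {ennreal s | s. 0 \<le> s \<and> hausdorff_measure s A = 0}"

text \<open>A system is a list of maps, so that equal maps at different positions count as
  different members.\<close>

text \<open>The word \<open>[i\<^sub>1, \<dots>, i\<^sub>k]\<close> denotes \<open>f\<^sub>i\<^sub>1 \<circ> \<dots> \<circ> f\<^sub>i\<^sub>k\<close>.\<close>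

definition ifs_word :: "('a \<Rightarrow> 'a) list \<Rightarrow> nat list \<Rightarrow> 'a \<Rightarrow> 'a" where
  "ifs_word F w = foldr (\<lambda>i g. F ! i \<circ> g) w id"

definition ifs_free :: "('a \<Rightarrow> 'a) list \<Rightarrow> bool" where
  "ifs_free F \<longleftrightarrow> inj_on (ifs_word F) {w. w \<noteq> [] \<and> set w \<subseteq> {..<length F}}"

definition open_set_condition :: "('a::topological_space \<Rightarrow> 'a) list \<Rightarrow> bool" where
  "open_set_condition F \<longleftrightarrow>
     (\<exists>W. open W \<and> W \<noteq> {} \<and> (\<Union>i<length F. (F ! i) ` W) \<subseteq> W \<and>
          disjoint_family_on (\<lambda>i. (F ! i) ` W) {..<length F})"

definition digit_list :: "nat \<Rightarrow> nat \<Rightarrow> nat list" where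
  "digit_list x y = [0, x, y, x + y]"

text \<open>The digit sequence is indexed from 0, so \<open>\<epsilon> n\<close> is the digit at \<open>4\<^bsup>-(n+1)\<^esup>\<close>.\<close>

definition E_set :: "nat \<Rightarrow> nat \<Rightarrow> real set" where
  "E_set x y =
     {(\<Sum>n. real (\<epsilon> n) / 4 ^ Suc n) | \<epsilon> :: nat \<Rightarrow> nat. \<forall>n. \<epsilon> n \<in> set (digit_list x y)}"

definition F_ifs :: "nat \<Rightarrow> nat \<Rightarrow> (real \<Rightarrow> real) list" where
  "F_ifs x y = map (\<lambda>d z. (z + real d) / 4) (digit_list x y)"

definition digit4 :: "nat \<Rightarrow> nat \<Rightarrow> nat" where
  "digit4 n k = n div 4 ^ k mod 4"

text \<open>Only meaningful for \<open>n > 0\<close>; the last digit is the least significant one.\<close>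

definition last_nonzero_digit4 :: "nat \<Rightarrow> nat" where
  "last_nonzero_digit4 n = digit4 n (LEAST k. digit4 n k \<noteq> 0)"

definition V_set :: "nat set" where
  "V_set = {n. n > 0 \<and> last_nonzero_digit4 n \<in> {1, 3}}"

definition c_fun :: "nat \<Rightarrow> nat" where
  "c_fun n = (if n \<in> V_set then 1 else 0)"

definition T_fun :: "nat \<Rightarrow> nat \<Rightarrow> nat" where
  "T_fun x y = (if c_fun x \<noteq> c_fun y then 1 else 0)"

end

theory Submission
  imports Defs
begin

text \<open>
  The value \<open>c n\<close> records the parity of the exponent of \<open>2\<close> in \<open>n\<close>: it is \<open>1\<close> for
  \<open>n = 4 ^ a * r\<close> and \<open>0\<close> for \<open>n = 4 ^ a * (2 * r)\<close>, with \<open>r\<close> odd.  So \<open>T x y = 1\<close> says that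
  these exponents for \<open>x\<close> and \<open>y\<close> have different parities.  The equivalences follow from a
  cycle of implications and a second chain from its interior statement to freeness:

  \<^item> \<open>T x y = 1\<close>, non-empty interior, open set condition, freeness, \<open>T x y = 1\<close>;
  \<^item> non-empty interior, positive measure, dimension \<open>1\<close>, freeness.

  If \<open>T x y = 1\<close>, then up to powers of \<open>4\<close>, which can be removed from \<open>x\<close> and \<open>y\<close> independently
  at the cost of passing to a subset of the attractor, one number is odd and the other is twice an
  odd number.  Then the four digits are a complete residue system modulo \<open>4\<close>, the integer
  translates of the attractor cover the line, and Baire's theorem gives interior points
  (\<open>interior_E_set\<close>).  The interior of the attractor is a feasible open set, since two of the four
  pieces, each with a quarter of the measure, cannot overlap in positive measure
  (\<open>open_set_condition_if_interior\<close>).  Under the open set condition, distinct words of the same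
  length map the open set to disjoint sets, so the system is free.

  The arithmetic core is that freeness implies \<open>T x y = 1\<close>.  A word of length \<open>k\<close> stands for the
  map \<open>z \<mapsto> (z + v) / 4 ^ k\<close> with an integer \<open>v\<close>, the value of the word, and freeness means that
  words of equal length have distinct values.  If this holds, then for every positive integer
  \<open>\<xi>\<close> the exponential sum over the values of all words of length \<open>l\<close> at the frequency
  \<open>\<xi> / 4 ^ l\<close> vanishes for large \<open>l\<close> (\<open>exponential_sum_words_eq_0\<close>).  But this sum is the
  product of the factors \<open>1 + \<omega> ^ (x * 4 ^ i)\<close> and \<open>1 + \<omega> ^ (y * 4 ^ i)\<close>, where
  \<open>\<omega> = exp (2 * pi * \<i> * \<xi> / 4 ^ l)\<close>, and such a factor can vanish only if the exponent of \<open>2\<close> in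
  \<open>\<xi> * x\<close> or in \<open>\<xi> * y\<close> is odd.  If \<open>x\<close> and \<open>y\<close> had exponents of the same parity, one of
  \<open>\<xi> = 1\<close> and \<open>\<xi> = 2\<close> would make both even, a contradiction.

  For the second chain, positive measure bounds the dimension from below because
  intervals enclosing the covering sets have the same diameters
  (\<open>emeasure_le_hausdorff_premeasure\<close>), and without freeness two words of some length \<open>k\<close> denote
  the same map, so that fewer than \<open>4 ^ k\<close> pieces of ratio \<open>1 / 4 ^ k\<close> cover the attractor and the
  dimension is less than \<open>1\<close> (\<open>hausdorff_dim_overlap_less_1\<close>).
\<close>

section \<open>Expansions in base 4\<close>

definition expansions :: "nat set \<Rightarrow> real set" where
  "expansions D = {(\<Sum>n. real (\<epsilon> n) / 4 ^ Suc n) | \<epsilon>. \<forall>n. \<epsilon> n \<in> D}"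

lemma E_set_eq_expansions: "E_set x y = expansions {0, x, y, x + y}"
  by (simp add: E_set_def expansions_def digit_list_def)

lemma sums_quarter_powers: "(\<lambda>n. C / 4 ^ Suc n) sums (C / 3 :: real)"
  using sums_mult[OF geometric_sums[of "1/4::real"], of "C/4"]
  by (simp add: power_divide)

lemma summable_expansion:
  fixes \<epsilon> :: "nat \<Rightarrow> nat"
  assumes "finite D" "\<And>n. \<epsilon> n \<in> D"
  shows "summable (\<lambda>n. real (\<epsilon> n) / 4 ^ Suc n)"
proof (rule summable_comparison_test')
  show "summable (\<lambda>n. real (Max D) / 4 ^ Suc n)"
    using sums_quarter_powers[of "real (Max D)"] by (simp only: sums_iff)
  show "norm (real (\<epsilon> n) / 4 ^ Suc n) \<le> real (Max D) / 4 ^ Suc n" for n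
    using assms by (simp add: divide_right_mono)
qed

lemma expansions_bounds:
  assumes "\<And>d. d \<in> D \<Longrightarrow> d \<le> C" "z \<in> expansions D"
  shows "0 \<le> z" "z \<le> real C / 3"
proof -
  obtain \<epsilon> where \<epsilon>: "\<And>n. \<epsilon> n \<in> D" and z: "z = (\<Sum>n. real (\<epsilon> n) / 4 ^ Suc n)"
    using assms(2) by (auto simp: expansions_def)
  have le: "\<epsilon> n \<le> C" for n using \<epsilon> assms(1) by blast
  have sm: "summable (\<lambda>n. real (\<epsilon> n) / 4 ^ Suc n)"
    using le by (intro summable_expansion[of "{..C}"]) auto
  show "0 \<le> z" unfolding z by (intro suminf_nonneg sm) simp
  have "z \<le> (\<Sum>n. real C / 4 ^ Suc n)" unfolding z
    using sums_quarter_powers[of "real C"] le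
    by (intro suminf_le sm divide_right_mono) (auto simp: sums_iff)
  then show "z \<le> real C / 3"
    using sums_quarter_powers[of "real C"] by (simp add: sums_iff)
qed

lemma bounded_expansions:
  assumes "finite D"
  shows "bounded (expansions D)"
proof -
  have "d \<le> Max D" if "d \<in> D" for d using assms that by simp
  from expansions_bounds[OF this] have "expansions D \<subseteq> {0..real (Max D) / 3}"
    by (auto intro: expansions_bounds)
  then show ?thesis using bounded_subset bounded_closed_interval by blast
qed

lemma zero_in_expansions: "0 \<in> D \<Longrightarrow> 0 \<in> expansions D"
  unfolding expansions_def by (auto intro!: exI[of _ "\<lambda>_. 0"])

lemma expansions_cons:
  assumes "finite D" "d \<in> D" "z \<in> expansions D"
  shows "(z + real d) / 4 \<in> expansions D"
proof -
  obtain \<epsilon> where \<epsilon>: "\<And>n. \<epsilon> n \<in> D" and z: "z = (\<Sum>n. real (\<epsilon> n) / 4 ^ Suc n)"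
    using assms(3) by (auto simp: expansions_def)
  define \<delta> where "\<delta> = case_nat d \<epsilon>"
  have \<delta>: "\<delta> n \<in> D" for n using assms(2) \<epsilon> by (cases n) (auto simp: \<delta>_def)
  have sm: "summable (\<lambda>n. real (\<epsilon> n) / 4 ^ Suc n)" "summable (\<lambda>n. real (\<delta> n) / 4 ^ Suc n)"
    using summable_expansion[OF assms(1)] \<epsilon> \<delta> by blast+
  have "(\<Sum>n. real (\<delta> n) / 4 ^ Suc n) = (\<Sum>n. real (\<delta> (Suc n)) / 4 ^ Suc (Suc n)) + real d / 4"
    using suminf_split_head[OF sm(2)] by (simp add: \<delta>_def)
  also have "(\<Sum>n. real (\<delta> (Suc n)) / 4 ^ Suc (Suc n)) = z / 4"
    unfolding z suminf_divide[OF sm(1), symmetric] by (simp add: \<delta>_def field_simps)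
  finally have "(z + real d) / 4 = (\<Sum>n. real (\<delta> n) / 4 ^ Suc n)" by (simp add: add_divide_distrib)
  then show ?thesis using \<delta> unfolding expansions_def by blast
qed

lemma expansions_decomp:
  assumes "finite D" "z \<in> expansions D"
  obtains d z' where "d \<in> D" "z' \<in> expansions D" "z = (z' + real d) / 4"
proof -
  obtain \<epsilon> where \<epsilon>: "\<And>n. \<epsilon> n \<in> D" and z: "z = (\<Sum>n. real (\<epsilon> n) / 4 ^ Suc n)"
    using assms(2) by (auto simp: expansions_def)
  have sm: "summable (\<lambda>n. real (\<epsilon> n) / 4 ^ Suc n)" "summable (\<lambda>n. real (\<epsilon> (Suc n)) / 4 ^ Suc n)"
    using summable_expansion[OF assms(1), of \<epsilon>] \<epsilon>
      summable_expansion[OF assms(1), of "\<lambda>n. \<epsilon> (Suc n)"] by blast+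
  define z' where "z' = (\<Sum>n. real (\<epsilon> (Suc n)) / 4 ^ Suc n)"
  have "z = (\<Sum>n. real (\<epsilon> (Suc n)) / 4 ^ Suc (Suc n)) + real (\<epsilon> 0) / 4"
    using suminf_split_head[OF sm(1)] by (simp add: z)
  also have "(\<Sum>n. real (\<epsilon> (Suc n)) / 4 ^ Suc (Suc n)) = z' / 4"
    unfolding z'_def suminf_divide[OF sm(2), symmetric] by (simp add: field_simps)
  finally have "z = (z' + real (\<epsilon> 0)) / 4" by (simp add: add_divide_distrib)
  moreover have "z' \<in> expansions D"
    unfolding z'_def expansions_def using \<epsilon> by (auto intro!: exI[of _ "\<lambda>n. \<epsilon> (Suc n)"])
  ultimately show ?thesis using that \<epsilon> by blast
qed

text \<open>Self-similarity only produces finitely many digits at a time.  This is the converse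
  passage to infinite expansions: a point of a bounded set that is covered by its own
  contracted copies can be expanded digit by digit, and the remainders, being bounded, are
  contracted away.\<close>

lemma bounded_self_covered_subset_expansions:
  fixes K :: "real set"
  assumes "bounded K"
    and cover: "\<And>z. z \<in> K \<Longrightarrow> \<exists>d\<in>D. 4 * z - real d \<in> K"
  shows "K \<subseteq> expansions D"
proof
  fix z assume z: "z \<in> K"
  obtain g where g: "\<And>z. z \<in> K \<Longrightarrow> g z \<in> D \<and> 4 * z - real (g z) \<in> K"
    using cover by metis
  obtain B where B: "\<And>z. z \<in> K \<Longrightarrow> \<bar>z\<bar> \<le> B"
    using assms(1) unfolding bounded_real by blast
  define u where "u n = ((\<lambda>z. 4 * z - real (g z)) ^^ n) z" for n
  have uK: "u n \<in> K" for n
    by (induction n) (use z g in \<open>auto simp: u_def\<close>)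
  have u_Suc: "u (Suc n) = 4 * u n - real (g (u n))" for n by (simp add: u_def)
  have partial: "(\<Sum>k<n. real (g (u k)) / 4 ^ Suc k) = z - u n / 4 ^ n" for n
  proof (induction n)
    case 0
    then show ?case by (simp add: u_def)
  next
    case (Suc n)
    then show ?case by (simp add: u_Suc field_simps)
  qed
  have "(\<lambda>n. u n / 4 ^ n) \<longlonglongrightarrow> 0"
  proof (rule Lim_null_comparison)
    show "\<forall>\<^sub>F n in sequentially. norm (u n / 4 ^ n) \<le> B / 4 ^ n"
      using B[OF uK] by (simp add: divide_right_mono)
    have "(\<lambda>n. B * (1/4) ^ n) \<longlonglongrightarrow> B * 0"
      by (intro tendsto_mult tendsto_const LIMSEQ_power_zero) simp
    then show "(\<lambda>n. B / 4 ^ n) \<longlonglongrightarrow> 0" by (simp add: power_divide)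
  qed
  then have "(\<lambda>n. z - u n / 4 ^ n) \<longlonglongrightarrow> z - 0"
    by (intro tendsto_diff tendsto_const)
  then have "(\<lambda>n. real (g (u n)) / 4 ^ Suc n) sums z"
    unfolding sums_def partial by simp
  then have "z = (\<Sum>n. real (g (u n)) / 4 ^ Suc n)" by (simp add: sums_iff)
  then show "z \<in> expansions D"
    unfolding expansions_def using g[OF uK] by (auto intro!: exI[of _ "\<lambda>n. g (u n)"])
qed

text \<open>The closure is itself covered by its contracted copies, because the images of a
  closed set under finitely many similarities have a closed union.\<close>

lemma compact_expansions:
  assumes "finite D"
  shows "compact (expansions D)"
proof -
  let ?K = "closure (expansions D)"
  have "closed ((\<lambda>z. (z + real d) / 4) ` ?K)" for d
  proof -
    have "(\<lambda>z. (z + real d) / 4) ` ?K = (\<lambda>z. real d / 4 + z) ` ((*\<^sub>R) (1/4) ` ?K)"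
      by (auto simp: image_image add_divide_distrib)
    then show ?thesis using closed_translation closed_scaling closed_closure by metis
  qed
  then have "closed (\<Union>d\<in>D. (\<lambda>z. (z + real d) / 4) ` ?K)" using assms by blast
  moreover have "expansions D \<subseteq> (\<Union>d\<in>D. (\<lambda>z. (z + real d) / 4) ` ?K)"
  proof
    fix z assume "z \<in> expansions D"
    then obtain d z' where "d \<in> D" "z' \<in> expansions D" "z = (z' + real d) / 4"
      using expansions_decomp assms by blast
    then show "z \<in> (\<Union>d\<in>D. (\<lambda>z. (z + real d) / 4) ` ?K)" using closure_subset by blast
  qed
  ultimately have sub: "?K \<subseteq> (\<Union>d\<in>D. (\<lambda>z. (z + real d) / 4) ` ?K)"
    by (rule closure_minimal[rotated])
  have "?K \<subseteq> expansions D"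
  proof (rule bounded_self_covered_subset_expansions)
    show "bounded ?K" using bounded_expansions[OF assms] by (rule bounded_closure)
    fix z assume "z \<in> ?K"
    then obtain d z' where "d \<in> D" "z' \<in> ?K" "z = (z' + real d) / 4" using sub by blast
    moreover from this have "4 * z - real d = z'" by simp
    ultimately show "\<exists>d\<in>D. 4 * z - real d \<in> ?K" by metis
  qed
  then have "?K = expansions D" using closure_subset by blast
  then show ?thesis
    using bounded_expansions[OF assms] closed_closure compact_eq_bounded_closed by metis
qed

section \<open>Words and their values\<close>

definition words :: "nat \<Rightarrow> nat list set" where
  "words k = {w. set w \<subseteq> {..<4} \<and> length w = k}"

text \<open>The word \<open>w\<close> of length \<open>k\<close> over the digits \<open>ds\<close> denotes the map
  \<open>z \<mapsto> (z + word_val ds w) / 4 ^ k\<close>: its value is the integer with the base 4 digits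
  selected by \<open>w\<close>, the first letter being the most significant one.\<close>

fun word_val :: "nat list \<Rightarrow> nat list \<Rightarrow> nat" where
  "word_val ds [] = 0"
| "word_val ds (i # w) = ds ! i * 4 ^ length w + word_val ds w"

lemma word_val_append: "word_val ds (u @ w) = word_val ds u * 4 ^ length w + word_val ds w"
  by (induction u) (auto simp: algebra_simps power_add)

lemma words_0: "words 0 = {[]}"
  by (auto simp: words_def)

lemma words_Suc: "words (Suc k) = (\<lambda>(w, i). i # w) ` (words k \<times> {..<4})"
  unfolding words_def by (rule lists_length_Suc_eq)

lemma finite_words: "finite (words k)" and card_words: "card (words k) = 4 ^ k"
  unfolding words_def using finite_lists_length_eq[of "{..<4::nat}" k]
    card_lists_length_eq[of "{..<4::nat}" k] by auto

lemma words_append: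
  "words (l + j) = (\<lambda>(u, w). u @ w) ` (words l \<times> words j)"
proof
  show "words (l + j) \<subseteq> (\<lambda>(u, w). u @ w) ` (words l \<times> words j)"
  proof
    fix v assume v: "v \<in> words (l + j)"
    then have "take l v \<in> words l" "drop l v \<in> words j"
      using set_take_subset[of l v] set_drop_subset[of l v] by (auto simp: words_def)
    moreover have "v = (\<lambda>(u, w). u @ w) (take l v, drop l v)" by simp
    ultimately show "v \<in> (\<lambda>(u, w). u @ w) ` (words l \<times> words j)" by blast
  qed
qed (auto simp: words_def)

lemma inj_on_words_append: "inj_on (\<lambda>(u, w). u @ w) (words l \<times> words j)"
  by (auto simp: inj_on_def words_def)

text \<open>The point of this bound is that \<open>word_val ds w div 4 ^ k\<close> takes at most \<open>C\<close> values,
  however large \<open>k\<close> is.  The geometric series gives more, namely \<open>C * (4 ^ k - 1) / 3\<close>, and the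
  induction has to carry this stronger estimate.\<close>

lemma word_val_less:
  assumes "w \<in> words k" "\<And>i. i < 4 \<Longrightarrow> ds ! i \<le> C" "0 < C"
  shows "word_val ds w < C * 4 ^ k"
proof -
  have "3 * word_val ds w + C \<le> C * 4 ^ length w" if "set w \<subseteq> {..<4}"
    using that
  proof (induction w)
    case (Cons i w)
    have "ds ! i * 4 ^ length w \<le> C * 4 ^ length w" using Cons.prems assms(2) by simp
    moreover have "3 * word_val ds w + C \<le> C * 4 ^ length w" using Cons by simp
    ultimately have "3 * (ds ! i * 4 ^ length w) + (3 * word_val ds w + C) \<le> 4 * (C * 4 ^ length w)"
      by linarith
    then show ?case by (simp add: algebra_simps)
  qed simp
  moreover have "length w = k" "set w \<subseteq> {..<4}" using assms(1) by (auto simp: words_def)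
  ultimately show ?thesis using assms(3) by auto
qed

lemma ifs_word_eq:
  assumes "length ds = 4" "w \<in> words k"
  shows "ifs_word (map (\<lambda>d z. (z + real d) / 4) ds) w = (\<lambda>z. (z + real (word_val ds w)) / 4 ^ k)"
proof -
  have "ifs_word (map (\<lambda>d z. (z + real d) / 4) ds) w
      = (\<lambda>z. (z + real (word_val ds w)) / 4 ^ length w)" if "set w \<subseteq> {..<4}"
    using that
  proof (induction w)
    case (Cons i w)
    then show ?case using assms(1) by (auto simp: ifs_word_def fun_eq_iff field_simps)
  qed (simp add: ifs_word_def fun_eq_iff)
  then show ?thesis using assms(2) by (simp add: words_def)
qed

lemma expansions_word:
  assumes "length ds = 4" "w \<in> words k" "z \<in> expansions (set ds)"
  shows "(z + real (word_val ds w)) / 4 ^ k \<in> expansions (set ds)"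
proof -
  have "(z + real (word_val ds w)) / 4 ^ length w \<in> expansions (set ds)" if "set w \<subseteq> {..<4}"
    using that
  proof (induction w)
    case (Cons i w)
    then have "((z + real (word_val ds w)) / 4 ^ length w + real (ds ! i)) / 4 \<in> expansions (set ds)"
      using assms(1) by (intro expansions_cons) auto
    then show ?case by (simp add: field_simps)
  qed (use assms(3) in simp)
  then show ?thesis using assms(2) by (simp add: words_def)
qed

lemma expansions_subset_word_images:
  assumes "length ds = 4"
  shows "expansions (set ds)
    \<subseteq> (\<Union>w\<in>words k. (\<lambda>z. (z + real (word_val ds w)) / 4 ^ k) ` expansions (set ds))"
proof (induction k)
  case 0
  then show ?case by (simp add: words_0)
next
  case (Suc k)
  show ?case
  proof
    fix z assume "z \<in> expansions (set ds)"
    then obtain d z' where d: "d \<in> set ds" "z' \<in> expansions (set ds)" "z = (z' + real d) / 4"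
      using expansions_decomp by (metis List.finite_set)
    obtain i where i: "i < 4" "d = ds ! i" using d(1) assms by (metis in_set_conv_nth)
    obtain w z'' where w: "w \<in> words k" "z'' \<in> expansions (set ds)"
      "z' = (z'' + real (word_val ds w)) / 4 ^ k" using Suc d(2) by blast
    have "i # w \<in> words (Suc k)" using i(1) w(1) by (auto simp: words_def)
    moreover have "z = (z'' + real (word_val ds (i # w))) / 4 ^ Suc k"
      using w d(3) i(2) by (auto simp: words_def add_divide_distrib)
    ultimately show "z \<in> (\<Union>w\<in>words (Suc k).
        (\<lambda>z. (z + real (word_val ds w)) / 4 ^ Suc k) ` expansions (set ds))"
      using w(2) by blast
  qed
qed

section \<open>Free systems have vanishing exponential sums\<close>

definition residue_words :: "nat list \<Rightarrow> nat \<Rightarrow> nat \<Rightarrow> nat list set" where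
  "residue_words ds j s = {w \<in> words j. word_val ds w mod 4 ^ j = s}"

text \<open>Values in the same residue class are told apart by their quotients by \<open>4 ^ j\<close>, of which
  there are at most \<open>C\<close>.\<close>

lemma card_residue_words_le:
  assumes "inj_on (word_val ds) (words j)" "\<And>i. i < 4 \<Longrightarrow> ds ! i \<le> C" "0 < C"
  shows "card (residue_words ds j s) \<le> C"
proof -
  let ?q = "\<lambda>w. word_val ds w div 4 ^ j"
  have "inj_on ?q (residue_words ds j s)"
  proof (rule inj_onI)
    fix v w assume vw: "v \<in> residue_words ds j s" "w \<in> residue_words ds j s" "?q v = ?q w"
    then have "word_val ds v = word_val ds w"
      unfolding residue_words_def by (metis (mono_tags, lifting) div_mod_decomp mem_Collect_eq)
    then show "v = w" using vw assms(1) by (auto simp: residue_words_def inj_on_def)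
  qed
  moreover have "?q ` residue_words ds j s \<subseteq> {..<C}"
    using word_val_less[OF _ assms(2,3)]
    by (auto simp: residue_words_def less_mult_imp_div_less)
  ultimately show ?thesis using card_inj_on_le[of ?q _ "{..<C}"] by simp
qed

lemma residue_words_append:
  "{v \<in> words (l + j). word_val ds v mod 4 ^ j = s}
     = (\<lambda>(u, w). u @ w) ` (words l \<times> residue_words ds j s)"
  unfolding words_append by (auto simp: residue_words_def word_val_append words_def image_iff)

lemma residue_words_refine:
  assumes "s < 4 ^ j" "c < 4 ^ l"
  shows "{v \<in> words (l + j). word_val ds v mod 4 ^ j = s \<and> word_val ds v div 4 ^ j mod 4 ^ l = c}
     = residue_words ds (l + j) (4 ^ j * c + s)"
proof -
  have "n mod 4 ^ (l + j) = 4 ^ j * (n div 4 ^ j mod 4 ^ l) + n mod 4 ^ j" for n :: nat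
    by (simp add: power_add mult.commute[of "4 ^ l"] mod_mult2_eq)
  moreover have "4 ^ j * a + b = 4 ^ j * c + s \<longleftrightarrow> b = s \<and> a = c" if "b < 4 ^ j" for a b :: nat
  proof
    assume eq: "4 ^ j * a + b = 4 ^ j * c + s"
    have "(4 ^ j * a + b) div 4 ^ j = a" "(4 ^ j * c + s) div 4 ^ j = c" using that assms by auto
    with eq have "a = c" by simp
    with eq show "b = s \<and> a = c" by simp
  qed simp
  ultimately show ?thesis unfolding residue_words_def by auto
qed

text \<open>This is a discrete form of the statement that the Fourier transform of normalised
  Lebesgue measure on an integral self-similar tile vanishes at every non-zero integer.
  If all words have distinct values, no residue class modulo \<open>4 ^ j\<close> contains more than
  \<open>C\<close> values of words of length \<open>j\<close>, so among all \<open>j\<close> and all classes there is a class \<open>s\<close>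
  with the largest number \<open>M\<close> of words.  Prefixing these words by all words of length \<open>l\<close> gives \<open>4 ^ l * M\<close> words in the
  \<open>4 ^ l\<close> classes refining \<open>s\<close>; by maximality each of these classes gets exactly \<open>M\<close>.
  An exponential sum of such an equidistributed family is zero.  The same sum factors into
  the exponential sum over all words and one over the boundedly many quotients
  \<open>word_val ds w div 4 ^ j\<close>, whose terms are all close to \<open>1\<close> when \<open>l\<close> is large.\<close>

lemma exponential_sum_words_eq_0:
  assumes inj: "\<And>k. inj_on (word_val ds) (words k)"
    and C: "\<And>i. i < 4 \<Longrightarrow> ds ! i \<le> C" "0 < C"
    and "0 < \<xi>" and l: "4 * C * \<xi> < 4 ^ l"
  shows "(\<Sum>u\<in>words l. cis (2 * pi * real \<xi> / 4 ^ l) ^ word_val ds u) = 0"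
proof -
  let ?\<omega> = "cis (2 * pi * real \<xi> / 4 ^ l)"
  have "\<exists>p. \<forall>q. card (residue_words ds (fst q) (snd q)) \<le> card (residue_words ds (fst p) (snd p))"
    using ex_has_greatest_nat[of "\<lambda>_. True" undefined
        "\<lambda>p. card (residue_words ds (fst p) (snd p))" "Suc C"]
      card_residue_words_le[OF inj C] by (simp only: less_Suc_eq_le simp_thms)
  then obtain j s where
    max: "\<And>j' s'. card (residue_words ds j' s') \<le> card (residue_words ds j s)" by auto
  define W where "W = residue_words ds j s"
  define M where "M = card W"
  define R where "R = {v \<in> words (l + j). word_val ds v mod 4 ^ j = s}"
  define t where "t = (\<lambda>w. word_val ds w div 4 ^ j)"
  have "residue_words ds 0 0 = {[]}" by (auto simp: residue_words_def words_0)
  then have "0 < M" using max[of 0 0] by (simp add: M_def W_def)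
  then have "W \<noteq> {}" "finite W" by (auto simp: M_def card_gt_0_iff)
  then have s: "s < 4 ^ j" by (auto simp: W_def residue_words_def)
  \<comment> \<open>\<open>R\<close> consists of the words in \<open>W\<close> with prefixes of length \<open>l\<close>; for \<open>v = u @ w\<close> the
    quotient \<open>t v\<close> is the sum of \<open>word_val ds u\<close> and \<open>t w\<close>\<close>
  have finR: "finite R" by (simp add: R_def finite_words)
  have R_eq: "R = (\<lambda>(u, w). u @ w) ` (words l \<times> W)"
    unfolding R_def W_def by (rule residue_words_append)
  have inj_app: "inj_on (\<lambda>(u, w). u @ w) (words l \<times> W)"
    by (rule inj_on_subset[OF inj_on_words_append]) (auto simp: W_def residue_words_def)
  have fiber: "{v \<in> R. t v mod 4 ^ l = c} = residue_words ds (l + j) (4 ^ j * c + s)"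
    if "c < 4 ^ l" for c
    using residue_words_refine[OF s that, of ds] by (auto simp: R_def t_def)
  have "(\<Sum>c<4 ^ l. card {v \<in> R. t v mod 4 ^ l = c}) = (\<Sum>v\<in>R. 1)"
    unfolding card_eq_sum by (rule sum.group) (auto simp: finR)
  also have "\<dots> = 4 ^ l * M"
    by (simp add: R_eq card_image[OF inj_app] card_cartesian_product card_words M_def)
  also have "\<dots> = (\<Sum>c<(4::nat) ^ l. M)" by simp
  finally have "card {v \<in> R. t v mod 4 ^ l = c} = M" if "c < 4 ^ l" for c
    by (rule sum_mono_inv) (use that max in \<open>auto simp: fiber M_def W_def\<close>)
  note equi = this
  have \<omega>1: "?\<omega> ^ 4 ^ l = 1"
    using cis_multiple_2pi[of "real \<xi>"] by (simp add: Complex.DeMoivre mult_ac)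
  have "?\<omega> \<noteq> 1"
  proof
    assume "?\<omega> = 1"
    then have "cos (2 * pi * real \<xi> / 4 ^ l) = 1" by (metis cis.simps(1) one_complex.sel(1))
    then obtain n :: int where "2 * pi * real \<xi> / 4 ^ l = real_of_int n * 2 * pi"
      unfolding cos_one_2pi_int by blast
    then have "real_of_int (int \<xi>) = real_of_int (n * 4 ^ l)" by (simp add: divide_eq_eq)
    then have n: "int \<xi> = n * 4 ^ l" by (simp only: of_int_eq_iff)
    moreover have "0 < int \<xi>" using \<open>0 < \<xi>\<close> by simp
    ultimately have "0 < n" by (simp add: zero_less_mult_iff)
    with n have "(4::int) ^ l \<le> int \<xi>" by simp
    moreover have "int \<xi> < 4 ^ l"
    proof -
      have "\<xi> \<le> 4 * C * \<xi>" using C(2) by simp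
      with l have "\<xi> < 4 ^ l" by linarith
      then show ?thesis by (metis of_nat_less_iff of_nat_numeral of_nat_power)
    qed
    ultimately show False by simp
  qed
  have \<omega>_mod: "?\<omega> ^ n = ?\<omega> ^ (n mod 4 ^ l)" for n
  proof -
    have "?\<omega> ^ n = (?\<omega> ^ 4 ^ l) ^ (n div 4 ^ l) * ?\<omega> ^ (n mod 4 ^ l)"
      unfolding power_mult[symmetric] power_add[symmetric] by simp
    then show ?thesis by (simp add: \<omega>1)
  qed
  have "(\<Sum>v\<in>R. ?\<omega> ^ t v) = (\<Sum>c<4 ^ l. \<Sum>v\<in>{v \<in> R. t v mod 4 ^ l = c}. ?\<omega> ^ t v)"
    by (rule sum.group[symmetric]) (auto simp: finR)
  also have "\<dots> = (\<Sum>c<4 ^ l. \<Sum>v\<in>{v \<in> R. t v mod 4 ^ l = c}. ?\<omega> ^ c)"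
    using \<omega>_mod by (intro sum.cong) auto
  also have "\<dots> = of_nat M * (\<Sum>c<4 ^ l. ?\<omega> ^ c)"
    by (simp add: equi sum_distrib_left)
  also have "(\<Sum>c<4 ^ l. ?\<omega> ^ c) = 0"
    using geometric_sum[OF \<open>?\<omega> \<noteq> 1\<close>, of "4 ^ l"] \<omega>1 by simp
  finally have "0 = (\<Sum>v\<in>R. ?\<omega> ^ t v)" by simp
  also have "\<dots> = (\<Sum>(u, w)\<in>words l \<times> W. ?\<omega> ^ t (u @ w))"
    unfolding R_eq sum.reindex[OF inj_app] by (simp add: case_prod_unfold)
  also have "\<dots> = (\<Sum>(u, w)\<in>words l \<times> W. ?\<omega> ^ word_val ds u * ?\<omega> ^ t w)"
    by (intro sum.cong refl)
      (auto simp: t_def word_val_append W_def residue_words_def words_def power_add)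
  also have "\<dots> = (\<Sum>u\<in>words l. ?\<omega> ^ word_val ds u) * (\<Sum>w\<in>W. ?\<omega> ^ t w)"
    by (simp add: sum_product sum.cartesian_product)
  finally have prod0: "(\<Sum>u\<in>words l. ?\<omega> ^ word_val ds u) * (\<Sum>w\<in>W. ?\<omega> ^ t w) = 0" by simp
  \<comment> \<open>\<open>t w < C\<close> keeps all angles below a right angle\<close>
  have "0 < (\<Sum>w\<in>W. Re (?\<omega> ^ t w))"
  proof (rule sum_pos)
    fix w assume "w \<in> W"
    then have "word_val ds w < C * 4 ^ j"
      using word_val_less[OF _ C] by (auto simp: W_def residue_words_def)
    then have "t w < C" by (simp add: t_def less_mult_imp_div_less)
    then have "4 * t w * \<xi> < 4 ^ l"
      using l by (meson le_less_trans less_imp_le_nat mult_le_mono1 mult_le_mono2)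
    then have "real (4 * t w * \<xi>) < real (4 ^ l)" by (simp only: of_nat_less_iff)
    then have "real (t w) * (2 * pi * real \<xi> / 4 ^ l) < pi / 2"
      by (simp add: field_simps)
    then show "0 < Re (?\<omega> ^ t w)"
      unfolding Complex.DeMoivre cis.simps by (intro cos_gt_zero_pi) (auto intro: less_le_trans[of _ 0])
  qed (use \<open>W \<noteq> {}\<close> \<open>finite W\<close> in auto)
  then have "(\<Sum>w\<in>W. ?\<omega> ^ t w) \<noteq> 0" by (metis Re_sum less_irrefl zero_complex.sel(1))
  with prod0 show ?thesis by simp
qed

text \<open>The factorisation reflects that \<open>{0, x, y, x + y}\<close> is the sum of \<open>{0, x}\<close> and \<open>{0, y}\<close>.\<close>

lemma exponential_sum_digit_list:
  fixes \<omega> :: complex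
  shows "(\<Sum>u\<in>words l. \<omega> ^ word_val (digit_list x y) u)
    = (\<Prod>i<l. (1 + \<omega> ^ (x * 4 ^ i)) * (1 + \<omega> ^ (y * 4 ^ i)))"
proof (induction l)
  case 0
  then show ?case by (simp add: words_0)
next
  case (Suc l)
  let ?ds = "digit_list x y"
  have inj: "inj_on (\<lambda>(w, i). i # w) (words l \<times> {..<4})" by (auto simp: inj_on_def)
  have "(\<Sum>u\<in>words (Suc l). \<omega> ^ word_val ?ds u)
      = (\<Sum>(w, i)\<in>words l \<times> {..<4}. \<omega> ^ word_val ?ds (i # w))"
    unfolding words_Suc sum.reindex[OF inj] by (simp add: case_prod_unfold)
  also have "\<dots> = (\<Sum>(w, i)\<in>words l \<times> {..<4}. \<omega> ^ word_val ?ds w * \<omega> ^ (?ds ! i * 4 ^ l))"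
    by (intro sum.cong refl) (auto simp: words_def power_add)
  also have "\<dots> = (\<Sum>w\<in>words l. \<omega> ^ word_val ?ds w) * (\<Sum>i<4. \<omega> ^ (?ds ! i * 4 ^ l))"
    by (simp add: sum_product sum.cartesian_product)
  also have "(\<Sum>i<4. \<omega> ^ (?ds ! i * 4 ^ l)) = (1 + \<omega> ^ (x * 4 ^ l)) * (1 + \<omega> ^ (y * 4 ^ l))"
    by (simp add: digit_list_def numeral_eq_Suc algebra_simps power_add)
  finally show ?case using Suc by (simp add: mult_ac)
qed

text \<open>A zero would require \<open>2 * r * 4 ^ (a + i)\<close> to be an odd multiple of \<open>4 ^ l\<close>,
  but the first number contains the prime \<open>2\<close> to an odd power, the second to an even one.\<close>

lemma one_plus_root_of_unity_neq_0:
  assumes "\<xi> * x = 4 ^ a * r" "odd r"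
  shows "1 + cis (2 * pi * real \<xi> / 4 ^ l) ^ (x * 4 ^ i) \<noteq> 0"
proof
  let ?\<theta> = "2 * pi * real \<xi> / 4 ^ l"
  assume "1 + cis ?\<theta> ^ (x * 4 ^ i) = 0"
  moreover have "cis ?\<theta> ^ (x * 4 ^ i) = cis (real (x * 4 ^ i) * ?\<theta>)"
    by (rule Complex.DeMoivre)
  ultimately have "cis (real (x * 4 ^ i) * ?\<theta>) = - 1"
    by (metis add_eq_0_iff)
  then have "cos (real (x * 4 ^ i) * ?\<theta>) = - 1"
    by (metis cis.simps(1) one_complex.sel(1) uminus_complex.sel(1))
  then obtain n :: int where
    n: "real (x * 4 ^ i) * ?\<theta> = (2 * real_of_int n + 1) * pi"
    unfolding cos_eq_minus1 by blast
  have "real (2 * (\<xi> * x) * 4 ^ i) * pi = real (x * 4 ^ i) * (2 * pi * real \<xi>)" by simp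
  also have "2 * pi * real \<xi> = ?\<theta> * 4 ^ l"
    by (rule nonzero_eq_divide_eq[THEN iffD1, symmetric, OF _ refl]) simp
  also have "real (x * 4 ^ i) * (?\<theta> * 4 ^ l) = (2 * real_of_int n + 1) * pi * 4 ^ l"
    unfolding n[symmetric] by (simp only: mult.assoc)
  also have "\<dots> = of_int ((2 * n + 1) * 4 ^ l) * pi" by simp
  finally have "real (2 * (\<xi> * x) * 4 ^ i) * pi = of_int ((2 * n + 1) * 4 ^ l) * pi" .
  then have "of_int (int (2 * (\<xi> * x) * 4 ^ i)) = (of_int ((2 * n + 1) * 4 ^ l) :: real)"
    by simp
  then have "int (2 * (\<xi> * x) * 4 ^ i) = (2 * n + 1) * 4 ^ l" by (simp only: of_int_eq_iff)
  then have eq: "2 * int r * 4 ^ (a + i) = (2 * n + 1) * 4 ^ l"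
    by (simp add: assms(1) power_add mult_ac)
  show False
  proof (cases "a + i < l")
    case True
    then obtain m where "l = (a + i) + Suc m" by (metis less_imp_Suc_add add_Suc_right)
    with eq have "4 ^ (a + i) * (2 * int r) = 4 ^ (a + i) * ((2 * n + 1) * (4 * 4 ^ m))"
      by (simp add: power_add mult_ac)
    then have "2 * int r = (2 * n + 1) * (4 * 4 ^ m)" by (subst (asm) mult_cancel_left) simp
    then have "int r = 2 * ((2 * n + 1) * 4 ^ m)" by simp
    then have "even (int r)" by simp
    with assms(2) show False by simp
  next
    case False
    then have "l \<le> a + i" by simp
    then obtain m where "a + i = l + m" by (metis le_Suc_ex)
    with eq have "4 ^ l * (2 * int r * 4 ^ m) = 4 ^ l * (2 * n + 1)"
      by (simp add: power_add mult_ac)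
    then have "2 * int r * 4 ^ m = 2 * n + 1" by (subst (asm) mult_cancel_left) simp
    moreover have "even (2 * int r * 4 ^ m)" by simp
    ultimately show False by simp
  qed
qed

text \<open>Under these hypotheses no factor of the exponential sum vanishes, whatever the length of
  the words, whereas distinct values would force it to vanish for long words.\<close>

lemma digit_list_not_inj:
  assumes "x > 0" "\<xi> > 0"
    and "\<xi> * x = 4 ^ a * r" "odd r" "\<xi> * y = 4 ^ b * q" "odd q"
  shows "\<exists>k. \<not> inj_on (word_val (digit_list x y)) (words k)"
proof (rule ccontr)
  assume "\<not> (\<exists>k. \<not> inj_on (word_val (digit_list x y)) (words k))"
  then have inj: "\<And>k. inj_on (word_val (digit_list x y)) (words k)" by blast
  have digits: "digit_list x y ! i \<le> x + y" if "i < 4" for i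
    using that by (auto simp: digit_list_def numeral_eq_Suc less_Suc_eq)
  obtain l where "4 * (x + y) * \<xi> < 4 ^ l"
    using power_gt_expt[of 4 "4 * (x + y) * \<xi>"] by auto
  then have "(\<Sum>u\<in>words l. cis (2 * pi * real \<xi> / 4 ^ l) ^ word_val (digit_list x y) u) = 0"
    using assms(1,2) by (intro exponential_sum_words_eq_0[OF inj digits]) auto
  moreover have "(\<Sum>u\<in>words l. cis (2 * pi * real \<xi> / 4 ^ l) ^ word_val (digit_list x y) u) \<noteq> 0"
    unfolding exponential_sum_digit_list
    using one_plus_root_of_unity_neq_0[OF assms(3,4)] one_plus_root_of_unity_neq_0[OF assms(5,6)]
    by simp
  ultimately show False by simp
qed

section \<open>Hausdorff dimension\<close>

lemma hausdorff_premeasure_le_finite_cover: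
  assumes "finite \<U>" "A \<subseteq> \<Union>\<U>" "\<And>U. U \<in> \<U> \<Longrightarrow> bounded U \<and> diameter U \<le> \<delta>" "0 \<le> \<delta>"
  shows "hausdorff_premeasure s \<delta> A \<le> (\<Sum>U\<in>\<U>. diam_power s U)"
proof -
  obtain h where h: "bij_betw h {..<card \<U>} \<U>"
    using ex_bij_betw_nat_finite[OF assms(1)] by (auto simp: atLeast0LessThan)
  define V where "V i = (if i < card \<U> then h i else {})" for i
  have "(\<Union>i. V i) = \<Union>\<U>"
    using h by (auto simp: V_def bij_betw_def split: if_splits)
  moreover have "bounded (V i) \<and> diameter (V i) \<le> \<delta>" for i
    using h assms(3,4) by (auto simp: V_def bij_betw_def)
  ultimately have "hausdorff_premeasure s \<delta> A \<le> (\<Sum>i. diam_power s (V i))"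
    unfolding hausdorff_premeasure_def using assms(2)
    by (intro Inf_lower CollectI exI[of _ V]) simp
  also have "\<dots> = (\<Sum>i<card \<U>. diam_power s (V i))"
    by (rule suminf_finite) (auto simp: V_def diam_power_def)
  also have "\<dots> = (\<Sum>U\<in>\<U>. diam_power s U)"
    using sum.reindex_bij_betw[OF h, of "diam_power s"] by (simp add: V_def)
  finally show ?thesis .
qed

lemma hausdorff_measure_eq_0_geometric_covers:
  assumes "0 < s" "0 < r" "r < 1" "0 < D" and small: "real N * r powr s < 1"
    and covers: "\<And>p. \<exists>\<U>. finite \<U> \<and> card \<U> \<le> N ^ p \<and> A \<subseteq> \<Union>\<U> \<and>
                  (\<forall>U\<in>\<U>. bounded U \<and> diameter U \<le> D * r ^ p)"
  shows "hausdorff_measure s A = 0"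
proof -
  have "hausdorff_premeasure s \<delta> A = 0" if "0 < \<delta>" for \<delta>
  proof -
    have bound: "hausdorff_premeasure s \<delta> A \<le> ennreal (D powr s * (real N * r powr s) ^ p)"
      if p: "D * r ^ p \<le> \<delta>" for p
    proof -
      obtain \<U> where \<U>: "finite \<U>" "card \<U> \<le> N ^ p" "A \<subseteq> \<Union>\<U>"
        "\<And>U. U \<in> \<U> \<Longrightarrow> bounded U \<and> diameter U \<le> D * r ^ p" using covers by meson
      have "hausdorff_premeasure s \<delta> A \<le> (\<Sum>U\<in>\<U>. diam_power s U)"
        using \<U> p \<open>0 < \<delta>\<close>
        by (intro hausdorff_premeasure_le_finite_cover) (auto intro: order.trans)
      also have "\<dots> \<le> (\<Sum>U\<in>\<U>. ennreal ((D * r ^ p) powr s))"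
        using \<U>(4) assms(1)
        by (intro sum_mono) (auto simp: diam_power_def intro!: ennreal_leI powr_mono2 diameter_ge_0)
      also have "\<dots> = ennreal (real (card \<U>) * (D * r ^ p) powr s)"
        by (simp add: ennreal_mult ennreal_of_nat_eq_real_of_nat)
      also have "\<dots> \<le> ennreal (real (N ^ p) * (D * r ^ p) powr s)"
        using \<U>(2) by (intro ennreal_leI mult_right_mono of_nat_mono) auto
      also have "(D * r ^ p) powr s = D powr s * (r powr s) ^ p"
        using assms by (simp add: powr_mult powr_powr mult.commute flip: powr_realpow)
      finally show ?thesis by (simp add: power_mult_distrib mult_ac)
    qed
    have "(\<lambda>p. D * r ^ p) \<longlonglongrightarrow> D * 0"
      using assms by (intro tendsto_mult tendsto_const LIMSEQ_power_zero) auto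
    then have "\<forall>\<^sub>F p in sequentially. D * r ^ p < \<delta>"
      using \<open>0 < \<delta>\<close> by (intro order_tendstoD(2)) auto
    then have ev: "\<forall>\<^sub>F p in sequentially.
        hausdorff_premeasure s \<delta> A \<le> ennreal (D powr s * (real N * r powr s) ^ p)"
      by eventually_elim (simp add: bound)
    have "(\<lambda>p. D powr s * (real N * r powr s) ^ p) \<longlonglongrightarrow> D powr s * 0"
      using small by (intro tendsto_mult tendsto_const LIMSEQ_power_zero) (simp add: abs_mult)
    then have "(\<lambda>p. ennreal (D powr s * (real N * r powr s) ^ p)) \<longlonglongrightarrow> ennreal 0"
      by (intro tendsto_ennrealI) simp
    from tendsto_lowerbound[OF this ev] show ?thesis by simp
  qed
  then show ?thesis by (auto simp: hausdorff_measure_def)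
qed

text \<open>A set covered by \<open>N\<close> copies of itself scaled by \<open>1 / b\<close> has dimension at most
  \<open>log b N\<close>: iterate the covering.\<close>

lemma hausdorff_measure_self_covered_eq_0:
  fixes K :: "real set"
  assumes "bounded K" "finite A" "1 < b" "0 < s" "real (card A) < b powr s"
    and cover: "K \<subseteq> (\<Union>a\<in>A. (\<lambda>z. (z + a) / b) ` K)"
  shows "hausdorff_measure s K = 0"
proof (rule hausdorff_measure_eq_0_geometric_covers)
  show "0 < 1 / b" "1 / b < 1" "0 < s" using assms by auto
  \<comment> \<open>the summand \<open>1\<close> makes the constant positive even if \<open>K\<close> has diameter \<open>0\<close>\<close>
  show "0 < diameter K + 1" using diameter_ge_0[OF assms(1)] by simp
  show "real (card A) * (1 / b) powr s < 1"
    using assms by (simp add: powr_divide)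
  show "\<exists>\<U>. finite \<U> \<and> card \<U> \<le> card A ^ p \<and> K \<subseteq> \<Union>\<U> \<and>
      (\<forall>U\<in>\<U>. bounded U \<and> diameter U \<le> (diameter K + 1) * (1 / b) ^ p)" for p
  proof (induction p)
    case 0
    show ?case by (intro exI[of _ "{K}"]) (use assms(1) in auto)
  next
    case (Suc p)
    then obtain \<U> where \<U>: "finite \<U>" "card \<U> \<le> card A ^ p" "K \<subseteq> \<Union>\<U>"
      "\<And>U. U \<in> \<U> \<Longrightarrow> bounded U \<and> diameter U \<le> (diameter K + 1) * (1 / b) ^ p" by blast
    let ?g = "\<lambda>(a, U). (\<lambda>z. (z + a) / b) ` U"
    show ?case
    proof (intro exI[of _ "?g ` (A \<times> \<U>)"] conjI ballI)
      show "finite (?g ` (A \<times> \<U>))" using assms(2) \<U>(1) by simp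
      have "card (?g ` (A \<times> \<U>)) \<le> card (A \<times> \<U>)"
        using assms(2) \<U>(1) by (intro card_image_le) simp
      also have "\<dots> \<le> card A ^ Suc p" using \<U>(2) by (simp add: card_cartesian_product)
      finally show "card (?g ` (A \<times> \<U>)) \<le> card A ^ Suc p" .
      show "K \<subseteq> \<Union> (?g ` (A \<times> \<U>))"
      proof
        fix z assume "z \<in> K"
        then obtain a z' where "a \<in> A" "z' \<in> K" "z = (z' + a) / b" using cover by blast
        moreover from this obtain U where "U \<in> \<U>" "z' \<in> U" using \<U>(3) by blast
        ultimately show "z \<in> \<Union> (?g ` (A \<times> \<U>))" by force
      qed
    next
      fix X assume "X \<in> ?g ` (A \<times> \<U>)"
      then obtain a U where U: "U \<in> \<U>" "X = (\<lambda>z. (z + a) / b) ` U" by auto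
      have X: "X = (\<lambda>z. a / b + z) ` ((*\<^sub>R) (1 / b) ` U)"
        unfolding U(2) by (auto simp: image_image add_divide_distrib)
      show "bounded X"
        unfolding X using \<U>(4)[OF U(1)] by (intro bounded_translation bounded_scaling) simp
      show "diameter X \<le> (diameter K + 1) * (1 / b) ^ Suc p"
      proof (rule diameter_le)
        show "X \<noteq> {} \<or> 0 \<le> (diameter K + 1) * (1 / b) ^ Suc p"
          using diameter_ge_0[OF assms(1)] assms(3) by simp
        fix u v assume "u \<in> X" "v \<in> X"
        then obtain u' v' where uv: "u' \<in> U" "v' \<in> U" "u = (u' + a) / b" "v = (v' + a) / b"
          unfolding U(2) by blast
        have "norm (u - v) = dist u' v' / b"
          using uv assms(3) by (simp add: dist_real_def diff_divide_distrib[symmetric])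
        also have "\<dots> \<le> (diameter K + 1) * (1 / b) ^ p / b"
          using diameter_bounded_bound[of U u' v'] uv(1,2) \<U>(4)[OF U(1)] assms(3)
          by (intro divide_right_mono) auto
        finally show "norm (u - v) \<le> (diameter K + 1) * (1 / b) ^ Suc p" by simp
      qed
    qed
  qed
qed

lemma hausdorff_dim_le: "0 \<le> s \<Longrightarrow> hausdorff_measure s A = 0 \<Longrightarrow> hausdorff_dim A \<le> ennreal s"
  unfolding hausdorff_dim_def by (intro Inf_lower) blast

lemma hausdorff_dim_expansions_le_1:
  assumes "length ds = 4"
  shows "hausdorff_dim (expansions (set ds)) \<le> 1"
proof (rule ennreal_le_epsilon)
  fix e :: real assume "0 < e"
  let ?K = "expansions (set ds)"
  have "hausdorff_measure (1 + e) ?K = 0"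
  proof (rule hausdorff_measure_self_covered_eq_0)
    show "?K \<subseteq> (\<Union>a\<in>real ` set ds. (\<lambda>z. (z + a) / 4) ` ?K)"
    proof
      fix z assume "z \<in> ?K"
      then obtain d z' where "d \<in> set ds" "z' \<in> ?K" "z = (z' + real d) / 4"
        using expansions_decomp by (metis List.finite_set)
      then show "z \<in> (\<Union>a\<in>real ` set ds. (\<lambda>z. (z + a) / 4) ` ?K)" by blast
    qed
    have "card (real ` set ds) \<le> 4"
      using card_image_le[of "set ds" real] card_length[of ds] assms by simp
    then have "real (card (real ` set ds)) \<le> 4 powr 1" by simp
    also have "\<dots> < 4 powr (1 + e)" using \<open>0 < e\<close> by (intro powr_less_mono) auto
    finally show "real (card (real ` set ds)) < 4 powr (1 + e)" .
  qed (use \<open>0 < e\<close> bounded_expansions in auto)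
  then show "hausdorff_dim ?K \<le> 1 + ennreal e"
    using hausdorff_dim_le[of "1 + e" ?K] \<open>0 < e\<close> by simp
qed

text \<open>An exact overlap at level \<open>k\<close> leaves fewer than \<open>4 ^ k\<close> pieces of ratio \<open>1 / 4 ^ k\<close>,
  so that the dimension drops.\<close>

lemma hausdorff_dim_overlap_less_1:
  assumes "length ds = 4" "\<not> inj_on (word_val ds) (words k)"
  shows "hausdorff_dim (expansions (set ds)) < 1"
proof -
  let ?K = "expansions (set ds)"
  let ?A = "(\<lambda>w. real (word_val ds w)) ` words k"
  have ninj: "\<not> inj_on (\<lambda>w. real (word_val ds w)) (words k)"
    using assms(2) by (simp add: inj_on_def)
  have "card ?A \<noteq> card (words k)"
    using ninj eq_card_imp_inj_on finite_words by blast
  then have lt: "card ?A < 4 ^ k"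
    using card_image_le[OF finite_words, of "\<lambda>w. real (word_val ds w)" k] by (simp add: card_words)
  have "words k \<noteq> {}" using card_words[of k] by auto
  then have pos: "0 < card ?A" using finite_words by (simp add: card_gt_0_iff)
  define N where "N = card ?A"
  have N: "1 \<le> N" "N + 1 \<le> 4 ^ k" using lt pos by (auto simp: N_def)
  have Nr: "real N + 1 \<le> 4 ^ k" using N(2) by (metis Suc_eq_plus1 of_nat_Suc of_nat_le_iff of_nat_numeral of_nat_power add.commute)
  \<comment> \<open>any exponent strictly between \<open>log (4 ^ k) N\<close> and \<open>1\<close> works\<close>
  define s where "s = log (4 ^ k) (real N + 1 / 2)"
  have b: "1 < (4::real) ^ k" using N Nr by linarith
  have s: "0 < s" "s < 1" using b N Nr by (auto simp: s_def)
  have "hausdorff_measure s ?K = 0"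
  proof (rule hausdorff_measure_self_covered_eq_0)
    show "?K \<subseteq> (\<Union>a\<in>?A. (\<lambda>z. (z + a) / 4 ^ k) ` ?K)"
      using expansions_subset_word_images[OF assms(1), of k] by simp
    have "(4 ^ k) powr s = real N + 1 / 2" using b N by (simp add: s_def)
    then show "real (card ?A) < (4 ^ k) powr s" by (simp add: N_def)
  qed (use b s bounded_expansions finite_words in auto)
  then have "hausdorff_dim ?K \<le> ennreal s" using s by (intro hausdorff_dim_le) auto
  also have "\<dots> < 1" using s by (metis ennreal_1 ennreal_lessI less_numeral_extra(1))
  finally show ?thesis .
qed

lemma bounded_real_subset_interval_diameter:
  fixes U :: "real set"
  assumes "bounded U" "U \<noteq> {}"
  shows "U \<subseteq> {Inf U..Sup U}" "Sup U - Inf U \<le> diameter U"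
proof -
  have bdd: "bdd_above U" "bdd_below U"
    using assms(1) bounded_imp_bdd_above bounded_imp_bdd_below by auto
  show "U \<subseteq> {Inf U..Sup U}" using bdd by (auto intro: cInf_lower cSup_upper)
  have "Sup U \<le> Inf U + diameter U"
  proof (rule cSup_least[OF assms(2)])
    fix u assume u: "u \<in> U"
    have "u - diameter U \<le> Inf U"
    proof (rule cInf_greatest[OF assms(2)])
      fix v assume "v \<in> U"
      then have "dist u v \<le> diameter U" using u assms(1) by (rule_tac diameter_bounded_bound)
      then show "u - diameter U \<le> v" by (simp add: dist_real_def)
    qed
    then show "u \<le> Inf U + diameter U" by simp
  qed
  then show "Sup U - Inf U \<le> diameter U" by simp
qed

text \<open>For sets of diameter at most \<open>1\<close> and \<open>s \<le> 1\<close>, the \<open>s\<close>-th power of the diameter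
  dominates the length of the smallest enclosing interval.\<close>

lemma emeasure_le_hausdorff_premeasure:
  fixes A :: "real set"
  assumes "0 \<le> s" "s \<le> 1"
  shows "emeasure lebesgue A \<le> hausdorff_premeasure s 1 A"
  unfolding hausdorff_premeasure_def
proof (rule Inf_greatest, clarify)
  fix U :: "nat \<Rightarrow> real set"
  assume U: "A \<subseteq> (\<Union>i. U i)" "\<forall>i. bounded (U i) \<and> diameter (U i) \<le> 1"
  define J where "J i = (if U i = {} then {} else {Inf (U i)..Sup (U i)})" for i
  have J: "emeasure lebesgue (J i) \<le> diam_power s (U i)" for i
  proof (cases "U i = {}")
    case False
    note iv = bounded_real_subset_interval_diameter[OF _ False]
    have d: "0 \<le> diameter (U i)" "diameter (U i) \<le> 1" using U(2) by (auto intro: diameter_ge_0)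
    have "Inf (U i) \<le> Sup (U i)" using iv(1) U(2) False by fastforce
    then have "emeasure lebesgue (J i) = ennreal (Sup (U i) - Inf (U i))"
      using False by (simp add: J_def)
    also have "\<dots> \<le> ennreal (diameter (U i))" using iv(2) U(2) by (intro ennreal_leI) auto
    also have "\<dots> \<le> diam_power s (U i)"
    proof (cases "s = 0 \<or> diameter (U i) = 0")
      case True
      then show ?thesis using False d by (auto simp: diam_power_def intro: ennreal_leI[of _ 1, simplified])
    next
      case ne: False
      then have "diameter (U i) powr 1 \<le> diameter (U i) powr s"
        using d assms by (intro powr_mono') auto
      then show ?thesis using False ne d by (simp add: diam_power_def ennreal_leI)
    qed
    finally show ?thesis .
  qed (simp add: J_def)
  have "A \<subseteq> (\<Union>i. J i)"
  proof
    fix z assume "z \<in> A"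
    then obtain i where "z \<in> U i" using U(1) by blast
    moreover from this have "U i \<subseteq> J i"
      using bounded_real_subset_interval_diameter(1)[of "U i"] U(2) by (simp add: J_def)
    ultimately show "z \<in> (\<Union>i. J i)" by blast
  qed
  moreover have Jm: "range J \<subseteq> sets lebesgue" by (auto simp: J_def)
  ultimately have "emeasure lebesgue A \<le> emeasure lebesgue (\<Union>i. J i)"
    by (intro emeasure_mono) auto
  also have "\<dots> \<le> (\<Sum>i. emeasure lebesgue (J i))"
    using Jm by (rule emeasure_subadditive_countably)
  also have "\<dots> \<le> (\<Sum>i. diam_power s (U i))" by (intro suminf_le J) auto
  finally show "emeasure lebesgue A \<le> (\<Sum>i. diam_power s (U i))" .
qed

lemma hausdorff_dim_ge_1:
  fixes A :: "real set"
  assumes "0 < emeasure lebesgue A"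
  shows "1 \<le> hausdorff_dim A"
  unfolding hausdorff_dim_def
proof (rule Inf_greatest, clarify)
  fix s :: real assume s: "0 \<le> s" "hausdorff_measure s A = 0"
  have "1 \<le> s"
  proof (rule ccontr)
    assume "\<not> 1 \<le> s"
    then have "emeasure lebesgue A \<le> hausdorff_premeasure s 1 A"
      using s(1) by (intro emeasure_le_hausdorff_premeasure) auto
    also have "\<dots> \<le> hausdorff_measure s A"
      unfolding hausdorff_measure_def by (rule SUP_upper) simp
    finally show False using s(2) assms by simp
  qed
  then show "1 \<le> ennreal s" by simp
qed

section \<open>Complete residue systems give interior\<close>

text \<open>Division with remainder, with the digits as representatives of the remainders.\<close>

lemma integer_expansion_complete_residues:
  assumes "length ds = 4"
    and complete: "\<And>n :: int. \<exists>i<4. n mod 4 = int (ds ! i) mod 4"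
  shows "\<exists>w\<in>words k. \<exists>m :: int. n = int (word_val ds w) + 4 ^ k * m"
proof (induction k)
  case 0
  then show ?case by (simp add: words_0)
next
  case (Suc k)
  then obtain w m where w: "w \<in> words k" "n = int (word_val ds w) + 4 ^ k * m" by blast
  obtain i where i: "i < 4" "m mod 4 = int (ds ! i) mod 4" using complete by blast
  then obtain m' where m': "m = int (ds ! i) + 4 * m'"
    by (metis mod_eqE)
  have "i # w \<in> words (Suc k)" using w(1) i(1) by (auto simp: words_def)
  moreover have "n = int (word_val ds (i # w)) + 4 ^ Suc k * m'"
    using w m' by (simp add: words_def algebra_simps)
  ultimately show ?case by blast
qed

text \<open>The integer translates of the attractor form a closed set, and expanding integers in
  base \<open>4\<close> with the given digits shows that it contains all fractions with denominators
  \<open>4 ^ k\<close>.  So the translates cover the line, and Baire's theorem applies.\<close>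

lemma interior_expansions_complete_residues:
  assumes ds: "length ds = 4" and "0 \<in> set ds"
    and complete: "\<And>n :: int. \<exists>i<4. n mod 4 = int (ds ! i) mod 4"
  shows "interior (expansions (set ds)) \<noteq> {}"
proof
  assume empty: "interior (expansions (set ds)) = {}"
  let ?K = "expansions (set ds)"
  let ?S = "\<Union>z\<in>?K. \<Union>m\<in>\<int>. {z + m}"
  have "closed ?S" by (intro compact_closed_sums compact_expansions) auto
  have frac: "real_of_int n / 4 ^ k \<in> ?S" for n k
  proof -
    obtain w m where w: "w \<in> words k" "n = int (word_val ds w) + 4 ^ k * m"
      using integer_expansion_complete_residues[OF ds complete] by blast
    have "(0 + real (word_val ds w)) / 4 ^ k \<in> ?K"
      by (intro expansions_word ds w zero_in_expansions assms)
    moreover have "real_of_int n / 4 ^ k = (0 + real (word_val ds w)) / 4 ^ k + of_int m"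
      using w(2) by (simp add: field_simps)
    ultimately show ?thesis by (metis (no_types, lifting) Ints_of_int UN_iff singletonI)
  qed
  have "t \<in> ?S" for t :: real
  proof (rule closed_sequentially[OF \<open>closed ?S\<close>])
    show "real_of_int \<lfloor>t * 4 ^ k\<rfloor> / 4 ^ k \<in> ?S" for k by (rule frac)
    have "(\<lambda>k. real_of_int \<lfloor>t * 4 ^ k\<rfloor> / 4 ^ k - t) \<longlonglongrightarrow> 0"
    proof (rule Lim_null_comparison)
      show "\<forall>\<^sub>F k in sequentially. norm (real_of_int \<lfloor>t * 4 ^ k\<rfloor> / 4 ^ k - t) \<le> (1 / 4) ^ k"
      proof (intro always_eventually allI)
        fix k :: nat
        have "real_of_int \<lfloor>t * 4 ^ k\<rfloor> / 4 ^ k - t = (real_of_int \<lfloor>t * 4 ^ k\<rfloor> - t * 4 ^ k) / 4 ^ k"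
          by (simp add: diff_divide_distrib)
        moreover have "\<bar>real_of_int \<lfloor>t * 4 ^ k\<rfloor> - t * 4 ^ k\<bar> \<le> 1" by linarith
        ultimately show "norm (real_of_int \<lfloor>t * 4 ^ k\<rfloor> / 4 ^ k - t) \<le> (1 / 4) ^ k"
          by (simp add: power_divide divide_right_mono)
      qed
      show "(\<lambda>k. (1 / 4 :: real) ^ k) \<longlonglongrightarrow> 0" by (rule LIMSEQ_power_zero) simp
    qed
    then show "(\<lambda>k. real_of_int \<lfloor>t * 4 ^ k\<rfloor> / 4 ^ k) \<longlonglongrightarrow> t" by (rule LIM_zero_cancel)
  qed
  then have cover: "\<exists>m\<in>\<int>. t - m \<in> ?K" for t :: real 
  proof -
    obtain z m where "z \<in> ?K" "m \<in> \<int>" "t = z + m" using \<open>\<And>t. t \<in> ?S\<close>[of t] by auto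
    then show ?thesis by (intro bexI[of _ m]) auto
  qed
  define G where "G = (\<lambda>m. - ((+) m ` ?K)) ` (\<int> :: real set)"
  have "UNIV \<subseteq> closure (\<Inter> G)"
  proof (rule Baire)
    have "countable (\<int> :: real set)" unfolding Ints_def by (intro countable_image) auto
    then show "countable G" unfolding G_def by (rule countable_image)
    fix T assume "T \<in> G"
    then obtain m where T: "T = - ((+) m ` ?K)" by (auto simp: G_def)
    have "closed ((+) m ` ?K)"
      by (intro closed_translation compact_imp_closed compact_expansions) simp
    moreover have "closure T = UNIV"
      unfolding T closure_complement interior_translation empty by simp
    ultimately show "openin (top_of_set UNIV) T \<and> UNIV \<subseteq> closure T"
      by (auto simp: T open_Compl)
  qed simp
  then have "\<Inter> G \<noteq> {}" by auto
  then obtain t where t: "\<And>m. m \<in> \<int> \<Longrightarrow> t \<notin> (+) m ` ?K" by (auto simp: G_def)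
  obtain m where "m \<in> \<int>" "t - m \<in> ?K" using cover by blast
  then have "t \<in> (+) m ` ?K" by (auto intro!: image_eqI[of _ _ "t - m"])
  with t \<open>m \<in> \<int>\<close> show False by blast
qed

text \<open>\<open>{0, x, y, x + y}\<close> is the sum of the digit sets \<open>{0, x}\<close> and \<open>{0, y}\<close>, so its attractor
  is a sum of two scaled copies of the set \<open>expansions {0, 1}\<close>.  The two scales can be
  changed independently.\<close>

lemma E_set_eq_sum:
  "E_set x y = {real x * m + real y * m' | m m'. m \<in> expansions {0, 1} \<and> m' \<in> expansions {0, 1}}"
    (is "_ = ?R")
proof
  have sm: "summable (\<lambda>n. real (p n) / 4 ^ Suc n)" if "\<And>n. p n \<in> {0, 1}" for p :: "nat \<Rightarrow> nat"
    using that by (rule summable_expansion[rotated]) simp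
  have suminf_eq: "(\<Sum>n. real (p n * x + q n * y) / 4 ^ Suc n)
      = real x * (\<Sum>n. real (p n) / 4 ^ Suc n) + real y * (\<Sum>n. real (q n) / 4 ^ Suc n)"
    if "\<And>n. p n \<in> {0, 1}" "\<And>n. q n \<in> {0, 1}" for p q :: "nat \<Rightarrow> nat"
  proof -
    have "(\<lambda>n. real x * (real (p n) / 4 ^ Suc n) + real y * (real (q n) / 4 ^ Suc n)) sums
        (real x * (\<Sum>n. real (p n) / 4 ^ Suc n) + real y * (\<Sum>n. real (q n) / 4 ^ Suc n))"
      by (intro sums_add sums_mult summable_sums sm that)
    moreover have "(\<lambda>n. real x * (real (p n) / 4 ^ Suc n) + real y * (real (q n) / 4 ^ Suc n))
        = (\<lambda>n. real (p n * x + q n * y) / 4 ^ Suc n)"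
      by (simp add: fun_eq_iff add_divide_distrib mult.commute)
    ultimately show ?thesis by (simp only: sums_iff)
  qed
  show "E_set x y \<subseteq> ?R"
  proof
    fix z assume "z \<in> E_set x y"
    then obtain \<epsilon> where \<epsilon>: "\<And>n. \<epsilon> n \<in> {0, x, y, x + y}" and z: "z = (\<Sum>n. real (\<epsilon> n) / 4 ^ Suc n)"
      unfolding E_set_eq_expansions expansions_def by blast
    have "\<exists>p q. p \<in> {0, 1} \<and> q \<in> {0, 1} \<and> \<epsilon> n = p * x + q * y" for n
    proof -
      have "\<epsilon> n = 0 * x + 0 * y \<or> \<epsilon> n = 1 * x + 0 * y \<or> \<epsilon> n = 0 * x + 1 * y \<or> \<epsilon> n = 1 * x + 1 * y"
        using \<epsilon>[of n] by auto
      then show ?thesis by blast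
    qed
    then obtain p q where pq: "\<And>n. p n \<in> {0, 1}" "\<And>n. q n \<in> {0, 1}" "\<And>n. \<epsilon> n = p n * x + q n * y"
      by metis
    show "z \<in> ?R"
      unfolding z pq(3) suminf_eq[OF pq(1,2)] using pq(1,2) unfolding expansions_def by blast
  qed
  show "?R \<subseteq> E_set x y"
  proof
    fix z assume "z \<in> ?R"
    then obtain p q where pq: "\<And>n. p n \<in> {0, 1}" "\<And>n. q n \<in> {0, 1}"
      "z = real x * (\<Sum>n. real (p n) / 4 ^ Suc n) + real y * (\<Sum>n. real (q n) / 4 ^ Suc n)"
      unfolding expansions_def by blast
    have "z = (\<Sum>n. real (p n * x + q n * y) / 4 ^ Suc n)"
      using suminf_eq[OF pq(1,2)] pq(3) by simp
    moreover have "p n * x + q n * y \<in> {0, x, y, x + y}" for n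
      using pq(1,2)[of n] by auto
    ultimately show "z \<in> E_set x y"
      unfolding E_set_eq_expansions expansions_def
      by (intro CollectI exI[of _ "\<lambda>n. p n * x + q n * y"]) blast
  qed
qed

lemma E_set_commute: "E_set x y = E_set y x"
  unfolding E_set_eq_expansions by (metis add.commute insert_commute)

lemma expansions_power_scale:
  assumes "finite D" "0 \<in> D" "z \<in> expansions D"
  shows "z / 4 ^ a \<in> expansions D"
proof (induction a)
  case (Suc a)
  then show ?case using expansions_cons[OF assms(1,2), of "z / 4 ^ a"] by (simp add: mult.commute)
qed (use assms in simp)

lemma E_set_power_scale: "E_set x y \<subseteq> E_set (4 ^ a * x) (4 ^ b * y)"
proof
  fix z assume "z \<in> E_set x y"
  then obtain m m' where m: "m \<in> expansions {0, 1}" "m' \<in> expansions {0, 1}"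
    "z = real x * m + real y * m'" unfolding E_set_eq_sum by blast
  have "z = real (4 ^ a * x) * (m / 4 ^ a) + real (4 ^ b * y) * (m' / 4 ^ b)" using m(3) by simp
  moreover have "m / 4 ^ a \<in> expansions {0, 1}" "m' / 4 ^ b \<in> expansions {0, 1}"
    using m by (auto intro: expansions_power_scale)
  ultimately show "z \<in> E_set (4 ^ a * x) (4 ^ b * y)" unfolding E_set_eq_sum by blast
qed

text \<open>After removing the powers of \<open>4\<close> the digits are congruent to \<open>0\<close>, \<open>r\<close>, \<open>2\<close> and
  \<open>r + 2\<close> modulo \<open>4\<close>, with \<open>r\<close> odd: a complete residue system.\<close>

lemma interior_E_set:
  assumes "odd r" "odd q"
  shows "interior (E_set (4 ^ a * r) (4 ^ b * (2 * q))) \<noteq> {}"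
proof -
  let ?ds = "digit_list r (2 * q)"
  have "interior (expansions (set ?ds)) \<noteq> {}"
  proof (rule interior_expansions_complete_residues)
    fix n :: int
    have r: "int r mod 4 = 1 \<or> int r mod 4 = 3" and q: "int (2 * q) mod 4 = 2"
      using assms by presburger+
    have "n mod 4 \<in> {0, 1, 2, 3}" by auto
    moreover have "int (r + 2 * q) mod 4 = (int r mod 4 + int (2 * q) mod 4) mod 4"
      by (simp add: mod_simps)
    ultimately have "n mod 4 = int (?ds ! 0) mod 4 \<or> n mod 4 = int (?ds ! 1) mod 4 \<or>
        n mod 4 = int (?ds ! 2) mod 4 \<or> n mod 4 = int (?ds ! 3) mod 4"
      using r q by (auto simp: digit_list_def numeral_eq_Suc)
    then show "\<exists>i<4. n mod 4 = int (?ds ! i) mod 4"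
      by (metis one_less_numeral_iff numeral_less_iff semiring_norm(76,78,79,80,81) zero_less_numeral)
  qed (auto simp: digit_list_def)
  then have "interior (E_set r (2 * q)) \<noteq> {}" by (simp add: E_set_eq_expansions digit_list_def)
  then show ?thesis using interior_mono[OF E_set_power_scale] by blast
qed

section \<open>Open set condition\<close>

text \<open>The interior of the attractor can serve as the open set.  Each of the four pieces has
  a quarter of the measure of the whole set, so two of them can overlap only in a null set,
  whereas overlapping images of the interior would overlap in a non-empty open set.\<close>

lemma open_set_condition_if_interior:
  assumes ds: "length ds = 4" and "interior (expansions (set ds)) \<noteq> {}"
  shows "open_set_condition (map (\<lambda>d z. (z + real d) / 4) ds)"
proof -
  let ?K = "expansions (set ds)"
  let ?W = "interior ?K"
  let ?f = "\<lambda>i z. (z + real (ds ! i)) / 4"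
  let ?\<mu> = "measure lebesgue"
  define P where "P i = ?f i ` ?K" for i
  define Q where "Q i = ?f i ` ?W" for i
  have f_eq: "?f i ` S = (\<lambda>z. real (ds ! i) / 4 + (1 / 4) *\<^sub>R z) ` S" for i S
    by (simp add: add_divide_distrib add.commute)
  have comp: "compact ?K" by (rule compact_expansions) simp
  then have K: "?K \<in> lmeasurable" by (rule lmeasurable_compact)
  have "compact (P i)" for i
    unfolding P_def using comp by (intro compact_continuous_image continuous_intros) auto
  then have P: "P i \<in> lmeasurable" for i by (rule lmeasurable_compact)
  have P_sets: "P i \<in> sets lebesgue" for i using P by (rule fmeasurableD)
  have meas: "?\<mu> (P i) = ?\<mu> ?K / 4" for i
    unfolding P_def f_eq using measure_lebesgue_affine[of "1 / 4" "real (ds ! i) / 4" ?K]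
    by (simp add: add.commute)
  have Q_open: "open (Q i)" for i
  proof -
    have "Q i = (+) (real (ds ! i) / 4) ` ((*\<^sub>R) (1 / 4) ` ?W)"
      unfolding Q_def f_eq by (simp add: image_image)
    then show ?thesis by (simp only:) (intro open_translation open_scaling open_interior, simp)
  qed
  have Q_subset: "Q i \<subseteq> P i" for i
    unfolding P_def Q_def using interior_subset by (rule image_mono)
  have P_subset: "P i \<subseteq> ?K" if "i < 4" for i
    unfolding P_def using that ds by (auto intro!: expansions_cons)
  have K_subset: "?K \<subseteq> (\<Union>i<4. P i)"
  proof
    fix z assume "z \<in> ?K"
    then obtain d z' where z: "d \<in> set ds" "z' \<in> ?K" "z = (z' + real d) / 4"
      using expansions_decomp by (metis List.finite_set)
    obtain k where "k < 4" "d = ds ! k" using z(1) ds by (metis in_set_conv_nth)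
    then have "z \<in> P k" using z(2,3) by (auto simp: P_def)
    then show "z \<in> (\<Union>i<4. P i)" using \<open>k < 4\<close> by blast
  qed
  have disj: "Q i \<inter> Q j = {}" if ij: "i < 4" "j < 4" "i \<noteq> j" for i j
  proof (rule ccontr)
    assume "Q i \<inter> Q j \<noteq> {}"
    then have "\<not> negligible (Q i \<inter> Q j)"
      using Q_open by (intro open_not_negligible open_Int)
    moreover have "Q i \<inter> Q j \<subseteq> P i \<inter> P j" using Q_subset by blast
    ultimately have "\<not> negligible (P i \<inter> P j)" using negligible_subset by blast
    then have "?\<mu> (P i \<inter> P j) \<noteq> 0"
      using negligible_iff_measure fmeasurable.Int[OF P P] by blast
    then have pos: "0 < ?\<mu> (P i \<inter> P j)" by (simp add: zero_less_measure_iff)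
    let ?I = "{..<4} - {i, j}"
    have rest: "(\<Union>k\<in>?I. P k) \<in> lmeasurable"
      by (intro fmeasurable.finite_UN P) simp
    have "?K \<subseteq> (P i \<union> P j) \<union> (\<Union>k\<in>?I. P k)" using K_subset by blast
    then have "?\<mu> ?K \<le> ?\<mu> ((P i \<union> P j) \<union> (\<Union>k\<in>?I. P k))"
      using K rest P by (intro measure_mono_fmeasurable fmeasurable.Un fmeasurableD)
    also have "\<dots> \<le> ?\<mu> (P i \<union> P j) + ?\<mu> (\<Union>k\<in>?I. P k)"
      by (intro measure_Un_le sets.Un P_sets fmeasurableD[OF rest])
    also have "?\<mu> (\<Union>k\<in>?I. P k) \<le> (\<Sum>k\<in>?I. ?\<mu> (P k))"
      using P_sets by (intro measure_UNION_le) auto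
    also have "\<dots> = real (card ?I) * (?\<mu> ?K / 4)" by (simp add: meas)
    also have "card ?I = 2" using ij by (simp add: card_Diff_subset)
    also have "?\<mu> (P i \<union> P j) = ?\<mu> (P i) + ?\<mu> (P j) - ?\<mu> (P i \<inter> P j)"
      using P by (intro measure_Un3)
    finally show False using pos by (simp add: meas)
  qed
  have Q_sub_W: "Q i \<subseteq> ?W" if "i < 4" for i
    using P_subset[OF that] Q_subset[of i] by (intro interior_maximal Q_open) blast
  let ?F = "map (\<lambda>d z. (z + real d) / 4) ds"
  have F: "(?F ! i) ` ?W = Q i" if "i < 4" for i using that ds by (simp add: Q_def)
  have "(\<Union>i<length ?F. (?F ! i) ` ?W) \<subseteq> ?W"
    using Q_sub_W F ds by (intro UN_least) simp
  moreover have "disjoint_family_on (\<lambda>i. (?F ! i) ` ?W) {..<length ?F}"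
    unfolding disjoint_family_on_def using disj F ds by simp
  ultimately show ?thesis
    unfolding open_set_condition_def using assms(2) by (intro exI[of _ ?W]) simp
qed

section \<open>Free systems\<close>

text \<open>The ratio of a composition determines the length of the word, and the translation part
  determines its value.\<close>

lemma ifs_free_iff_inj_word_val:
  assumes ds: "length ds = 4"
  shows "ifs_free (map (\<lambda>d z. (z + real d) / 4) ds) \<longleftrightarrow> (\<forall>k. inj_on (word_val ds) (words k))"
proof -
  let ?F = "map (\<lambda>d z. (z + real d) / 4) ds"
  have eq_iff: "ifs_word ?F v = ifs_word ?F w \<longleftrightarrow> k = l \<and> word_val ds v = word_val ds w"
    if "v \<in> words k" "w \<in> words l" for v w k l
  proof
    assume eq: "ifs_word ?F v = ifs_word ?F w"
    have *: "(z + real (word_val ds v)) / 4 ^ k = (z + real (word_val ds w)) / 4 ^ l" for z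
      using fun_cong[OF eq, of z] ifs_word_eq[OF ds that(1)] ifs_word_eq[OF ds that(2)] by simp
    have "1 / 4 ^ k = (1 / 4 ^ l :: real)"
      using *[of 0] *[of 1] by (simp add: add_divide_distrib)
    then have "(4::real) ^ k = 4 ^ l" by simp
    then have "k = l" by simp
    then show "k = l \<and> word_val ds v = word_val ds w" using *[of 0] by simp
  next
    assume "k = l \<and> word_val ds v = word_val ds w"
    then show "ifs_word ?F v = ifs_word ?F w"
      using ifs_word_eq[OF ds that(1)] ifs_word_eq[OF ds that(2)] by simp
  qed
  have words: "{w. w \<noteq> [] \<and> set w \<subseteq> {..<length ?F}} = (\<Union>k. words (Suc k))"
    using ds by (auto simp: words_def Suc_length_conv) (metis length_Suc_conv list.exhaust)
  show ?thesis
  proof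
    assume free: "ifs_free ?F"
    show "\<forall>k. inj_on (word_val ds) (words k)"
    proof
      fix k show "inj_on (word_val ds) (words k)"
      proof (cases k)
        case (Suc k')
        show ?thesis
        proof (rule inj_onI)
          fix v w assume vw: "v \<in> words k" "w \<in> words k" "word_val ds v = word_val ds w"
          then have "ifs_word ?F v = ifs_word ?F w" using eq_iff by blast
          then show "v = w"
            using free vw Suc unfolding ifs_free_def words inj_on_def by blast
        qed
      qed (simp add: words_0)
    qed
  next
    assume inj: "\<forall>k. inj_on (word_val ds) (words k)"
    show "ifs_free ?F"
      unfolding ifs_free_def words
    proof (rule inj_onI)
      fix v w assume "v \<in> (\<Union>k. words (Suc k))" "w \<in> (\<Union>k. words (Suc k))"
        and eq: "ifs_word ?F v = ifs_word ?F w"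
      then obtain k l where kl: "v \<in> words k" "w \<in> words l" by blast
      with eq have "k = l" "word_val ds v = word_val ds w" using eq_iff by blast+
      with kl inj show "v = w" by (auto simp: inj_on_def)
    qed
  qed
qed

text \<open>At the first letter in which two words of the same length differ, the open set
  condition puts the images of the open set into disjoint sets.\<close>

lemma inj_word_val_if_open_set_condition:
  assumes ds: "length ds = 4" and osc: "open_set_condition (map (\<lambda>d z. (z + real d) / 4) ds)"
  shows "inj_on (word_val ds) (words k)"
proof -
  let ?f = "\<lambda>i z. (z + real (ds ! i)) / 4"
  let ?F = "map (\<lambda>d z. (z + real d) / 4) ds"
  have F: "length ?F = 4" "?F ! i = ?f i" if "i < 4" for i using that ds by auto
  obtain W where osc_W: "W \<noteq> {}" "(\<Union>i<length ?F. (?F ! i) ` W) \<subseteq> W"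
    "disjoint_family_on (\<lambda>i. (?F ! i) ` W) {..<length ?F}"
    using osc unfolding open_set_condition_def by blast
  have W: "?f i ` W \<subseteq> W" if "i < 4" for i
    using osc_W(2) F[OF that] that by auto
  have disj: "?f i ` W \<inter> ?f j ` W = {}" if "i < 4" "j < 4" "i \<noteq> j" for i j
    using disjoint_family_onD[OF osc_W(3), of i j] F[OF that(1)] F(2)[OF that(2)] that by simp
  obtain z where z: "z \<in> W" using osc_W(1) by blast
  define g where "g w = (z + real (word_val ds w)) / 4 ^ length w" for w
  have g_Cons: "g (i # w) = ?f i (g w)" for i w by (simp add: g_def field_simps)
  have gW: "g w \<in> W" if "set w \<subseteq> {..<4}" for w
    using that
  proof (induction w)
    case (Cons i w)
    then show ?case unfolding g_Cons using W[of i] by auto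
  qed (simp add: g_def z)
  have "v = w" if "v \<in> words k" "w \<in> words k" "g v = g w" for v w
    using that
  proof (induction k arbitrary: v w)
    case (Suc k)
    then obtain i v' j w' where *: "v = i # v'" "w = j # w'" "v' \<in> words k" "w' \<in> words k" "i < 4" "j < 4"
      by (auto simp: words_Suc)
    have eq: "?f i (g v') = ?f j (g w')" using Suc.prems(3) unfolding *(1,2) g_Cons .
    have "set v' \<subseteq> {..<4}" "set w' \<subseteq> {..<4}" using *(3,4) by (simp_all add: words_def)
    then have "g v' \<in> W" "g w' \<in> W" using gW by blast+
    then have "?f i (g v') \<in> ?f i ` W" "?f j (g w') \<in> ?f j ` W" by blast+
    then have "i = j" using disj[OF *(5,6)] unfolding eq by blast
    moreover from this eq have "g v' = g w'" by simp
    ultimately show ?case using Suc.IH[OF *(3,4)] *(1,2) by simp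
  qed (simp add: words_0)
  then show ?thesis by (auto simp: inj_on_def words_def g_def)
qed

section \<open>The last non-zero digit\<close>

lemma last_nonzero_digit4_eq:
  assumes "\<not> 4 dvd r"
  shows "last_nonzero_digit4 (4 ^ k * r) = r mod 4"
proof -
  have d: "digit4 (4 ^ k * r) k = r mod 4" by (simp add: digit4_def)
  have "(LEAST i. digit4 (4 ^ k * r) i \<noteq> 0) = k"
  proof (rule Least_equality)
    show "digit4 (4 ^ k * r) k \<noteq> 0" using d assms by (simp add: dvd_eq_mod_eq_0)
    fix i assume i: "digit4 (4 ^ k * r) i \<noteq> 0"
    show "k \<le> i"
    proof (rule ccontr)
      assume "\<not> k \<le> i"
      then obtain m where "k = i + Suc m" by (metis less_imp_Suc_add add_Suc_right not_le)
      then have "4 ^ k * r = 4 ^ i * (4 * (4 ^ m * r))" by (simp add: power_add)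
      then have "4 ^ k * r div 4 ^ i = 4 * (4 ^ m * r)"
        by (metis nonzero_mult_div_cancel_left power_not_zero zero_neq_numeral)
      then have "digit4 (4 ^ k * r) i = 0" by (simp only: digit4_def mod_mult_self1_is_0)
      with i show False by simp
    qed
  qed
  then show ?thesis using d by (simp add: last_nonzero_digit4_def)
qed

lemma power4_times_odd_or_double_odd:
  assumes "n > 0"
  shows "(\<exists>a r. n = 4 ^ a * r \<and> odd r \<and> c_fun n = 1) \<or> (\<exists>a r. n = 4 ^ a * (2 * r) \<and> odd r \<and> c_fun n = 0)"
proof -
  have "\<exists>a q. n = 4 ^ a * q \<and> \<not> 4 dvd q"
    using assms
  proof (induction n rule: less_induct)
    case (less n)
    show ?case
    proof (cases "4 dvd n")
      case True
      then obtain m where m: "n = 4 * m" by (elim dvdE)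
      with less.prems have "m < n" "m > 0" by auto
      with less.IH obtain a q where "m = 4 ^ a * q" "\<not> 4 dvd q" by blast
      then show ?thesis using m by (intro exI[of _ "Suc a"] exI[of _ q]) simp
    next
      case False
      then show ?thesis by (intro exI[of _ 0] exI[of _ n]) simp
    qed
  qed
  then obtain a q where q: "n = 4 ^ a * q" "\<not> 4 dvd q" by blast
  have c: "c_fun n = (if q mod 4 \<in> {1, 3} then 1 else 0)"
    using assms last_nonzero_digit4_eq[OF q(2), of a]
    unfolding q(1)[symmetric] by (simp add: c_fun_def V_set_def)
  show ?thesis
  proof (cases "odd q")
    case True
    then have "q mod 4 = 1 \<or> q mod 4 = 3" by presburger
    then have "c_fun n = 1" using c by auto
    then show ?thesis using q(1) True by blast
  next
    case False
    then have "even q" by simp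
    then obtain r where r: "q = 2 * r" by (elim evenE)
    then have "odd r" using q(2) by auto
    have "q mod 4 \<noteq> 1" "q mod 4 \<noteq> 3" using r by presburger+
    then have "c_fun n = 0" using c by simp
    then show ?thesis using q(1) \<open>odd r\<close> unfolding r by blast
  qed
qed

lemma T_fun_eq_1_imp_interior:
  assumes "x > 0" "y > 0" "T_fun x y = 1"
  shows "interior (E_set x y) \<noteq> {}"
proof -
  have "c_fun x \<noteq> c_fun y" using assms(3) by (simp add: T_fun_def split: if_splits)
  then obtain a b r q where "odd r" "odd q"
    "x = 4 ^ a * r \<and> y = 4 ^ b * (2 * q) \<or> y = 4 ^ a * r \<and> x = 4 ^ b * (2 * q)"
    using power4_times_odd_or_double_odd[OF assms(1)] power4_times_odd_or_double_odd[OF assms(2)]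
    by metis
  then show ?thesis using interior_E_set E_set_commute by metis
qed

text \<open>If both numbers are powers of \<open>4\<close> times odd numbers, the exponential sums at \<open>\<xi> = 1\<close>
  do not vanish; otherwise both are twice such numbers and \<open>\<xi> = 2\<close> serves.\<close>

lemma inj_word_val_imp_T_fun_eq_1:
  assumes "x > 0" "y > 0" "\<And>k. inj_on (word_val (digit_list x y)) (words k)"
  shows "T_fun x y = 1"
proof (rule ccontr)
  assume "T_fun x y \<noteq> 1"
  then have "c_fun x = c_fun y" by (simp add: T_fun_def split: if_splits)
  then consider
      a b r q where "odd r" "odd q" "x = 4 ^ a * r" "y = 4 ^ b * q"
    | a b r q where "odd r" "odd q" "x = 4 ^ a * (2 * r)" "y = 4 ^ b * (2 * q)"
    using power4_times_odd_or_double_odd[OF assms(1)] power4_times_odd_or_double_odd[OF assms(2)]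
    by (metis zero_neq_one)
  then show False
  proof cases
    case 1
    then show False using digit_list_not_inj[OF assms(1), of 1 a r y b q] assms(3) by auto
  next
    case 2
    then show False
      using digit_list_not_inj[OF assms(1), of 2 "Suc a" r y "Suc b" q] assms(3) by auto
  qed
qed

theorem proposition3p1:
  fixes x y :: nat
  assumes "x > 0" and "y > 0"
  shows "(T_fun x y = 1 \<longleftrightarrow> interior (E_set x y) \<noteq> {}) \<and>
         (T_fun x y = 1 \<longleftrightarrow> emeasure lebesgue (E_set x y) > 0) \<and>
         (T_fun x y = 1 \<longleftrightarrow> hausdorff_dim (E_set x y) = 1) \<and>
         (T_fun x y = 1 \<longleftrightarrow> ifs_free (F_ifs x y)) \<and>
         (T_fun x y = 1 \<longleftrightarrow> open_set_condition (F_ifs x y))"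
proof -
  let ?ds = "digit_list x y"
  let ?inj = "\<forall>k. inj_on (word_val ?ds) (words k)"
  have ds: "length ?ds = 4" by (simp add: digit_list_def)
  have E: "E_set x y = expansions (set ?ds)" by (simp add: E_set_eq_expansions digit_list_def)
  have "T_fun x y = 1 \<Longrightarrow> interior (E_set x y) \<noteq> {}"
    using T_fun_eq_1_imp_interior assms by blast
  moreover have "interior (E_set x y) \<noteq> {} \<Longrightarrow> open_set_condition (F_ifs x y)"
    unfolding E F_ifs_def by (rule open_set_condition_if_interior[OF ds])
  moreover have "open_set_condition (F_ifs x y) \<Longrightarrow> ?inj"
    unfolding F_ifs_def using inj_word_val_if_open_set_condition[OF ds] by blast
  moreover have "?inj \<Longrightarrow> T_fun x y = 1"
    using inj_word_val_imp_T_fun_eq_1[OF assms] by blast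
  moreover have "ifs_free (F_ifs x y) \<longleftrightarrow> ?inj"
    unfolding F_ifs_def by (rule ifs_free_iff_inj_word_val[OF ds])
  moreover have "emeasure lebesgue (E_set x y) > 0" if "interior (E_set x y) \<noteq> {}"
  proof -
    have "E_set x y \<in> sets lebesgue"
      unfolding E using compact_expansions[of "set ?ds"] lmeasurable_compact by blast
    moreover have "\<not> negligible (E_set x y)"
      using that negligible_subset[OF _ interior_subset] open_not_negligible[OF open_interior] by blast
    ultimately show ?thesis by (simp add: negligible_iff_null_sets null_sets_def zero_less_iff_neq_zero)
  qed
  moreover have "hausdorff_dim (E_set x y) = 1" if "emeasure lebesgue (E_set x y) > 0"
    using hausdorff_dim_ge_1[OF that] hausdorff_dim_expansions_le_1[OF ds] unfolding E by simp
  moreover have "?inj" if "hausdorff_dim (E_set x y) = 1"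
    using that hausdorff_dim_overlap_less_1[OF ds] unfolding E by (metis less_irrefl)
  ultimately show ?thesis by argo
qed

end
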